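(* Let $d,m\ge1$. Let $S$ be the set of all $(x_0,A,G)\in\mathbb{R}^{d+d^2+dm}$ (with $x_0\in\mathbb{R}^d$, $A\in\mathbb{R}^{d\times d}$, $G\in\mathbb{R}^{d\times m}$) for which the condition $$\operatorname{rank}\big([x_0\,|\,Ax_0\,|\cdots|\,A^{d-1}x_0\,|\,H_{\cdot 1}\,|\,AH_{\cdot 1}\,|\cdots|\,A^{d-1}H_{\cdot 1}\,|\cdots|\,H_{\cdot d}\,|\,AH_{\cdot d}\,|\cdots|\,A^{d-1}H_{\cdot d}]\big)=d$$ is violated, where $H:=GG^{\top}$ and $H_{\cdot j}$ is the $j$-th column of $H$. Then $S$ has Lebesgue measure zero in $\mathbb{R}^{d+d^2+dm}$.
   Context: $[\,\cdot\,|\cdots|\,\cdot\,]$ denotes horizontal concatenation of columns. A triple $(x_0,A,G)$ is identified with a point of $\mathbb{R}^{d+d^2+dm}$ via its entries. *)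

theory Defs
  imports "HOL-Analysis.Analysis"
begin

(* The library's ^ on vectors and matrices is componentwise, hence this definition. *)
primrec matpow :: "real^'d^'d \<Rightarrow> nat \<Rightarrow> real^'d^'d" where
  "matpow A 0 = mat 1"
| "matpow A (Suc k) = A ** matpow A k"

(* A bijection from the index type 'd onto {0, ..., d - 1}, where d = CARD('d). *)
definition idx :: "'d::finite \<Rightarrow> nat" where
  "idx = to_nat_on UNIV"

(* The matrix [x0 | A x0 | ... | A^(d-1) x0 | H_1 | ... | A^(d-1) H_1 | ... | H_d | ... | A^(d-1) H_d]
   with H = G G^T. Its d (d + 1) columns are indexed by 'd option \<times> 'd: the first component
   selects the block (None for x0, Some j for the j-th column of H) and the second one,
   via idx, the exponent of A. *)
definition block_mat ::
    "real^'d \<Rightarrow> real^'d^'d \<Rightarrow> real^'m^'d \<Rightarrow> real^('d option \<times> 'd)^'d" where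
  "block_mat x0 A G =
     (\<chi> i c. (matpow A (idx (snd c)) *v
        (case fst c of None \<Rightarrow> x0 | Some j \<Rightarrow> column j (G ** transpose G))) $ i)"

lemma bij_betw_idx: "bij_betw (idx :: 'd::finite \<Rightarrow> nat) UNIV {..<CARD('d)}"
  unfolding idx_def by (rule to_nat_on_finite) simp

lemma columns_block_mat:
  fixes x0 :: "real^'d" and A :: "real^'d^'d" and G :: "real^'m^'d"
  shows "columns (block_mat x0 A G) =
    {matpow A k *v x0 | k. k < CARD('d)} \<union>
    {matpow A k *v column j (G ** transpose G) | j k. k < CARD('d)}"
proof -
  have col: "column c (block_mat x0 A G) = matpow A (idx (snd c)) *v
      (case fst c of None \<Rightarrow> x0 | Some j \<Rightarrow> column j (G ** transpose G))" for c
    by (simp add: block_mat_def column_def vec_eq_iff)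
  have 1: "idx k < CARD('d)" for k :: 'd
    using bij_betw_idx[where 'd = 'd] by (auto simp: bij_betw_def)
  have 2: "\<exists>l :: 'd. k = idx l" if "k < CARD('d)" for k
    using bij_betw_idx[where 'd = 'd] that by (auto simp: bij_betw_def image_iff set_eq_iff)
  show ?thesis (is "?L = ?R")
  proof
    show "?L \<subseteq> ?R"
      unfolding columns_def col using 1 by (fastforce split: option.splits)
    show "?R \<subseteq> ?L"
    proof
      fix v assume "v \<in> ?R"
      then consider k where "v = matpow A k *v x0" "k < CARD('d)"
        | j k where "v = matpow A k *v column j (G ** transpose G)" "k < CARD('d)"
        by blast
      then show "v \<in> ?L"
      proof cases
        case (1 k)
        with 2 obtain l :: 'd where "k = idx l" by blast
        with 1 have "v = column (None, l) (block_mat x0 A G)" by (simp add: col)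
        then show ?thesis by (auto simp: columns_def)
      next
        case (2 j k)
        with \<open>\<And>k. k < CARD('d) \<Longrightarrow> \<exists>l :: 'd. k = idx l\<close> obtain l :: 'd where "k = idx l" by blast
        with 2 have "v = column (Some j, l) (block_mat x0 A G)" by (simp add: col)
        then show ?thesis by (auto simp: columns_def)
      qed
    qed
  qed
qed

(* The triples (x0, A, G) form a Euclidean space whose standard basis is given by the entries. *)
lemma DIM_triples:
  "DIM((real^'d) \<times> (real^'d^'d) \<times> (real^'m^'d)) =
     CARD('d) + CARD('d) ^ 2 + CARD('d) * CARD('m)"
  by (simp add: power2_eq_square)

end

theory Submission
  imports Defs
begin

text \<open>
  The first \<open>d\<close> columns of the block matrix form the square Krylov matrix
  \<open>K = [x0 | A x0 | \<dots> | A^(d-1) x0]\<close>. If \<open>det K \<noteq> 0\<close>, these columns span the whole space and the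
  block matrix has rank \<open>d\<close> (lemma \<open>rank_block_mat\<close>), so the exceptional set lies in
  the zero set of the function \<open>(x0, A, G) \<mapsto> det K\<close>. This function is a polynomial in the entries
  (\<open>real_polynomial_function_det_krylov\<close>). It does not vanish identically: for \<open>x0\<close> the first basis
  vector and \<open>A\<close> the nilpotent shift matrix, \<open>K\<close> is the identity (\<open>krylov_shift\<close>).

  It remains to see that a polynomial \<open>f\<close> with \<open>f a \<noteq> 0\<close> for some \<open>a\<close> has a null zero set \<open>Z\<close>
  (\<open>negligible_zeros_real_polynomial_function\<close>). Along each line through \<open>a\<close>, \<open>f\<close> is a nonzero
  polynomial in one variable, so it has finitely many zeros there. By Fubini's theorem, for almost
  every \<open>t\<close> the set of all \<open>x\<close> with \<open>a + t (x - a) \<in> Z\<close> is null. For \<open>t \<noteq> 0\<close> this set is an affine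
  copy of \<open>Z\<close>, hence \<open>Z\<close> is null as well.
\<close>

lemma finite_zeros_real_polynomial_function:
  fixes f :: "real \<Rightarrow> real"
  assumes "real_polynomial_function f" "f s \<noteq> 0"
  shows "finite {t. f t = 0}"
proof -
  obtain c n where f: "f = (\<lambda>t. \<Sum>i\<le>n. c i * t ^ i)"
    using real_polynomial_function_imp_sum[OF assms(1)] by blast
  have "\<exists>k\<le>n. c k \<noteq> 0"
    using assms(2) unfolding f by (metis polyfun_eq_0)
  then have "finite {t. (\<Sum>i\<le>n. c i * t ^ i) = 0}"
    by (simp add: polyfun_finite_roots)
  then show ?thesis by (simp add: f)
qed

lemma negligible_zeros_real_polynomial_function:
  fixes f :: "'a::euclidean_space \<Rightarrow> real"
  assumes f: "real_polynomial_function f" and a: "f a \<noteq> 0"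
  shows "negligible {x. f x = 0}"
proof -
  have cont: "continuous_on UNIV f"
    using continuous_real_polymonial_function[OF f] by (simp add: continuous_on_eq_continuous_at)
  have fin: "finite {t. f (a + t *\<^sub>R (x - a)) = 0}" for x
  proof (rule finite_zeros_real_polynomial_function)
    have "polynomial_function (\<lambda>t. a + t *\<^sub>R (x - a))"
      by (intro polynomial_function_add polynomial_function_const polynomial_function_bounded_linear
          bounded_linear_scaleR_left)
    then show "real_polynomial_function (\<lambda>t. f (a + t *\<^sub>R (x - a)))"
      using real_polynomial_function_compose[OF _ f] by (fastforce simp: o_def)
    show "f (a + 0 *\<^sub>R (x - a)) \<noteq> 0" using a by simp
  qed
  have "AE x in lborel. AE t in lborel. f (a + t *\<^sub>R (x - a)) \<noteq> 0"
    by (intro AE_I2 AE_I'[OF finite_imp_null_set_lborel[OF fin]]) auto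
  moreover have "open {p :: real \<times> 'a. f (a + fst p *\<^sub>R (snd p - a)) \<noteq> 0}"
    by (intro open_Collect_neq continuous_on_compose2[OF cont] continuous_intros) auto
  then have "{p \<in> space (lborel \<Otimes>\<^sub>M lborel). f (a + fst p *\<^sub>R (snd p - a)) \<noteq> 0}
      \<in> sets (lborel \<Otimes>\<^sub>M lborel)"
    unfolding lborel_prod by simp
  ultimately have "AE t in lborel. AE x in lborel. f (a + t *\<^sub>R (x - a)) \<noteq> 0"
    by (subst lborel_pair.AE_commute)
  moreover have "AE t in lborel. t \<noteq> (0 :: real)"
    by (rule AE_lborel_singleton)
  ultimately have "AE t in lborel. t \<noteq> 0 \<and> (AE x in lborel. f (a + t *\<^sub>R (x - a)) \<noteq> 0)"
    by eventually_elim auto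
  then have "\<exists>t. t \<noteq> 0 \<and> (AE x in lborel. f (a + t *\<^sub>R (x - a)) \<noteq> 0)"
    by (rule eventually_happens'[rotated]) (simp add: ae_filter_eq_bot_iff)
  then obtain t where t: "t \<noteq> 0" and ae: "AE x in lborel. f (a + t *\<^sub>R (x - a)) \<noteq> 0"
    by blast
  let ?Z = "{x. f (a + t *\<^sub>R (x - a)) = 0}"
  obtain N where N: "N \<in> null_sets lebesgue"
      "\<And>x. x \<in> space lebesgue - N \<Longrightarrow> f (a + t *\<^sub>R (x - a)) \<noteq> 0"
    using AE_E3[OF AE_completion[OF ae]] by blast
  then have "negligible N" "?Z \<subseteq> N" by (auto simp: negligible_iff_null_sets)
  then have "negligible ?Z" by (rule negligible_subset)
  then have "negligible ((\<lambda>x. a + t *\<^sub>R (x - a)) ` ?Z)"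
    by (rule negligible_differentiable_image_negligible[rotated]) (auto intro!: derivative_intros)
  moreover have "{x. f x = 0} \<subseteq> (\<lambda>x. a + t *\<^sub>R (x - a)) ` ?Z"
  proof
    fix x assume "x \<in> {x. f x = 0}"
    then have "a + inverse t *\<^sub>R (x - a) \<in> ?Z" using t by simp
    moreover have "x = a + t *\<^sub>R ((a + inverse t *\<^sub>R (x - a)) - a)" using t by simp
    ultimately show "x \<in> (\<lambda>x. a + t *\<^sub>R (x - a)) ` ?Z" by (rule rev_image_eqI)
  qed
  ultimately show ?thesis by (rule negligible_subset)
qed

text \<open>The Krylov matrix \<open>[x0 | A x0 | \<dots> | A^(d-1) x0]\<close>: column \<open>j\<close> carries the exponent \<open>idx j\<close>.\<close>

definition krylov :: "real^'d \<Rightarrow> real^'d^'d \<Rightarrow> real^'d^'d" where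
  "krylov x0 A = (\<chi> i j. (matpow A (idx j) *v x0) $ i)"

lemma rank_block_mat:
  fixes x0 :: "real^'d" and A :: "real^'d^'d" and G :: "real^'m^'d"
  assumes "det (krylov x0 A) \<noteq> 0"
  shows "rank (block_mat x0 A G) = CARD('d)"
proof -
  have "column j (krylov x0 A) = column (None, j) (block_mat x0 A G)" for j
    by (simp add: column_def krylov_def block_mat_def)
  then have "columns (krylov x0 A) \<subseteq> columns (block_mat x0 A G)"
    by (auto simp: columns_def)
  then have "rank (krylov x0 A) \<le> rank (block_mat x0 A G)"
    by (simp add: column_rank_def dim_subset)
  moreover have "rank (krylov x0 A) = CARD('d)"
    using assms by (simp add: full_rank_injective invertible_det_nz[symmetric]
        invertible_left_inverse matrix_left_invertible_injective)
  moreover have "rank (block_mat x0 A G) \<le> CARD('d)"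
    by (metis rank_bound min.boundedE)
  ultimately show ?thesis by simp
qed

lemma real_polynomial_function_matpow_mult:
  fixes x :: "'a::real_normed_vector \<Rightarrow> real^'d" and A :: "'a \<Rightarrow> real^'d^'d"
  assumes "\<And>i. real_polynomial_function (\<lambda>p. x p $ i)"
    and "\<And>i j. real_polynomial_function (\<lambda>p. A p $ i $ j)"
  shows "real_polynomial_function (\<lambda>p. (matpow (A p) k *v x p) $ i)"
proof (induction k arbitrary: i)
  case 0
  then show ?case using assms(1) by simp
next
  case (Suc k)
  have "(matpow (A p) (Suc k) *v x p) $ i
      = (\<Sum>j\<in>UNIV. A p $ i $ j * (matpow (A p) k *v x p) $ j)" for p
    by (simp add: matrix_vector_mul_assoc[symmetric] matrix_vector_mult_def[of "A p"])
  then show ?case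
    using Suc assms(2) by (auto intro!: real_polynomial_function_sum real_polynomial_function.intros(4))
qed

lemma real_polynomial_function_det:
  fixes M :: "'a::real_normed_vector \<Rightarrow> real^'d^'d"
  assumes "\<And>i j. real_polynomial_function (\<lambda>p. M p $ i $ j)"
  shows "real_polynomial_function (\<lambda>p. det (M p))"
  unfolding det_def
  by (intro real_polynomial_function_sum real_polynomial_function.intros(4)
      real_polynomial_function.intros(2) real_polynomial_function_prod assms)
     (auto intro: finite_permutations)

lemma real_polynomial_function_det_krylov:
  "real_polynomial_function
     (\<lambda>p :: (real^'d) \<times> (real^'d^'d) \<times> (real^'m^'d). det (krylov (fst p) (fst (snd p))))"
proof -
  let ?A = "\<lambda>p :: (real^'d) \<times> (real^'d^'d) \<times> (real^'m^'d). fst (snd p)"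
  have "bounded_linear (\<lambda>p :: (real^'d) \<times> (real^'d^'d) \<times> (real^'m^'d). fst p $ i)" for i
    by (intro bounded_linear_compose[OF bounded_linear_vec_nth] bounded_linear_fst)
  moreover have "bounded_linear (\<lambda>p. ?A p $ i $ j)" for i j
    by (intro bounded_linear_compose[OF bounded_linear_vec_nth]
        bounded_linear_compose[OF bounded_linear_fst] bounded_linear_snd)
  ultimately have "real_polynomial_function (\<lambda>p. krylov (fst p) (?A p) $ i $ j)" for i j
    by (simp add: krylov_def real_polynomial_function_matpow_mult real_polynomial_function.intros(1))
  then show ?thesis by (rule real_polynomial_function_det)
qed

lemma idx_eq_iff: "idx i = idx j \<longleftrightarrow> i = (j :: 'd::finite)"
  using bij_betw_idx[where 'd = 'd] by (auto simp: bij_betw_def inj_on_def)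

text \<open>
  With respect to the enumeration of the coordinates by \<open>idx\<close>, the vector below is the first basis
  vector \<open>e_0\<close>, and the matrix maps \<open>e_k\<close> to \<open>e_(k+1)\<close> and \<open>e_(d-1)\<close> to \<open>0\<close>.
\<close>

lemma krylov_shift:
  "krylov (\<chi> i. if idx i = 0 then 1 else 0)
     (\<chi> i j. if idx i = Suc (idx j) then 1 else 0) = (mat 1 :: real^'d^'d)"
proof -
  let ?x = "(\<chi> i. if idx i = 0 then 1 else 0) :: real^'d"
  let ?A = "(\<chi> i j. if idx i = Suc (idx j) then 1 else 0) :: real^'d^'d"
  have "(matpow ?A k *v ?x) $ i = (if idx i = k then 1 else 0)" if "k < CARD('d)" for k i
    using that
  proof (induction k arbitrary: i)
    case 0
    then show ?case by simp
  next
    case (Suc k)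
    have "k \<in> range (idx :: 'd \<Rightarrow> nat)"
      using Suc.prems bij_betw_idx[where 'd = 'd] by (auto simp: bij_betw_def)
    then obtain l :: 'd where l: "k = idx l" by blast
    have "(matpow ?A (Suc k) *v ?x) $ i = (\<Sum>j\<in>UNIV. ?A $ i $ j * (matpow ?A k *v ?x) $ j)"
      by (simp add: matrix_vector_mul_assoc[symmetric] matrix_vector_mult_def[of ?A])
    also have "\<dots> = (\<Sum>j\<in>UNIV. if j = l then ?A $ i $ j else 0)"
      using Suc by (intro sum.cong) (auto simp: l idx_eq_iff)
    also have "\<dots> = (if idx i = Suc k then 1 else 0)" by (simp add: l)
    finally show ?case .
  qed
  moreover have "idx j < CARD('d)" for j :: 'd
    using bij_betw_idx[where 'd = 'd] by (auto simp: bij_betw_def)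
  ultimately show ?thesis
    by (simp add: krylov_def mat_def vec_eq_iff idx_eq_iff)
qed

theorem propositionB2:
  shows "{(x0 :: real^'d, A :: real^'d^'d, G :: real^'m^'d).
            rank (block_mat x0 A G) \<noteq> CARD('d)} \<in> null_sets lebesgue"
proof -
  let ?f = "\<lambda>p :: (real^'d) \<times> (real^'d^'d) \<times> (real^'m^'d). det (krylov (fst p) (fst (snd p)))"
  let ?a = "(\<chi> i. if idx i = 0 then 1 else 0, \<chi> i j. if idx i = Suc (idx j) then 1 else 0, 0)
    :: (real^'d) \<times> (real^'d^'d) \<times> (real^'m^'d)"
  have "?f ?a \<noteq> 0" by (simp add: krylov_shift)
  then have "negligible {p. ?f p = 0}"
    by (rule negligible_zeros_real_polynomial_function[OF real_polynomial_function_det_krylov])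
  then have "negligible {(x0 :: real^'d, A :: real^'d^'d, G :: real^'m^'d).
      rank (block_mat x0 A G) \<noteq> CARD('d)}"
    by (rule negligible_subset) (clarsimp, metis rank_block_mat)
  then show ?thesis by (simp add: negligible_iff_null_sets)
qed

end
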